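(* Let $\lambda\in\mathbb{C}_p$ with $\lambda\ne0$ and $|\lambda|_p\le1$ ($p$ an odd prime). For every $n\ge0$ and every odd positive integer $d$, \[ Ch_{n,\lambda}=\sum_{m=0}^n d^m\sum_{a=0}^{d-1}(-1)^a\,\mathcal{E}_{m,\lambda/d}\!\left(\frac{a}{d}\right)S_1(n,m). \]
   Context: $S_1(n,m)$ are the signed Stirling numbers of the first kind: $x(x-1)\cdots(x-n+1)=\sum_{m=0}^nS_1(n,m)x^m$. Write $(x)_{0,\lambda}=1$, $(x)_{n,\lambda}=x(x-\lambda)\cdots(x-(n-1)\lambda)$, and $(1+\lambda u)^{x/\lambda}=\sum_{m\ge0}(x)_{m,\lambda}u^m/m!$. Carlitz's degenerate Euler polynomials (for any nonzero parameter $\mu$): $\frac{2}{(1+\mu t)^{1/\mu}+1}(1+\mu t)^{x/\mu}=\sum_{n\ge0}\mathcal{E}_{n,\mu}(x)\frac{t^n}{n!}$. The degenerate Changhee polynomials of the second kind: $\frac{2}{1+(1+\lambda\log(1+t))^{1/\lambda}}(1+\lambda\log(1+t))^{x/\lambda}=\sum_{n\ge0}Ch_{n,\lambda}(x)\frac{t^n}{n!}$, with $Ch_{n,\lambda}=Ch_{n,\lambda}(0)$. *)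

theory Defs
  imports "HOL-Analysis.Analysis" "HOL-Computational_Algebra.Computational_Algebra"
begin

section \<open>The field of $p$-adic complex numbers\<close>

text \<open>
  The libraries contain no $\mathbb{C}_p$, so it is described axiomatically, as a completion of
  an algebraic closure of a completion of $\mathbb{Q}$ for $|\cdot|_p$. These axioms determine the
  valued field up to isometric isomorphism.
\<close>

locale nonarch_abs =
  fixes absv :: "'a::field \<Rightarrow> real"
  assumes absv_nonneg: "absv x \<ge> 0"
    and absv_eq_0_iff: "absv x = 0 \<longleftrightarrow> x = 0"
    and absv_mult: "absv (x * y) = absv x * absv y"
    and absv_ultrametric: "absv (x + y) \<le> max (absv x) (absv y)"
begin

lemma absv_1: "absv 1 = 1"
  using absv_mult[of 1 1] absv_eq_0_iff[of 1] by simp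

lemma absv_minus: "absv (- x) = absv x"
proof -
  have "absv (-1) * absv (-1) = 1"
    using absv_mult[of "-1" "-1"] absv_1 by simp
  then have "absv (-1) = 1"
    using absv_nonneg[of "-1"] by (simp add: square_eq_1_iff)
  then show ?thesis
    using absv_mult[of "-1" x] by simp
qed

sublocale absv: Metric_space UNIV "\<lambda>x y. absv (x - y)"
proof
  show "absv (x - y) = absv (y - x)" for x y
    using absv_minus[of "x - y"] by simp
  show "absv (x - z) \<le> absv (x - y) + absv (y - z)" for x y z
    using absv_ultrametric[of "x - y" "y - z"] absv_nonneg[of "x - y"] absv_nonneg[of "y - z"]
    by simp
qed (simp_all add: absv_nonneg absv_eq_0_iff)

end

definition algebraic_over :: "'a::field set \<Rightarrow> 'a \<Rightarrow> bool" where
  "algebraic_over K x \<longleftrightarrow> (\<exists>q. q \<noteq> 0 \<and> (\<forall>i. coeff q i \<in> K) \<and> poly q x = 0)"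

text \<open>
  By multiplicativity and the ultrametric inequality, the value of \<^term>\<open>absp (of_nat p)\<close>
  already forces \<^term>\<open>absp\<close> to be the normalised $p$-adic absolute value on the rationals.
\<close>

locale padic_complex = nonarch_abs absp
  for p :: nat and absp :: "'a::field_char_0 \<Rightarrow> real" +
  assumes prime_p: "prime p"
    and absp_p: "absp (of_nat p) = 1 / real p"
    and complete: "absv.mcomplete"
    and roots_over_Qp:
      "\<lbrakk>degree q > 0; \<forall>i. coeff q i \<in> absv.mtopology closure_of \<rat>\<rbrakk> \<Longrightarrow> \<exists>x. poly q x = 0"
    and algebraic_dense:
      "absv.mtopology closure_of {x. algebraic_over (absv.mtopology closure_of \<rat>) x} = UNIV"


section \<open>Stirling numbers and degenerate powers\<close>

definition S1 :: "nat \<Rightarrow> nat \<Rightarrow> int" where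
  "S1 n m = coeff (\<Prod>i<n. [:- int i, 1:]) m"

lemma S1_expansion:
  fixes x :: int
  shows "(\<Prod>i<n. x - int i) = (\<Sum>m\<le>n. S1 n m * x ^ m)"
proof -
  have "degree (\<Prod>i<n. [:- int i, 1:]) = n"
    by (subst degree_prod_eq_sum_degree) auto
  then have "(\<Sum>m\<le>n. S1 n m * x ^ m) = poly (\<Prod>i<n. [:- int i, 1:]) x"
    by (simp add: poly_altdef S1_def)
  then show ?thesis
    by (simp add: poly_prod)
qed

definition dfalling :: "'a::comm_ring_1 \<Rightarrow> 'a \<Rightarrow> nat \<Rightarrow> 'a" where
  "dfalling lam x n = (\<Prod>i<n. x - of_nat i * lam)"

text \<open>The formal power series $(1 + \lambda u)^{x/\lambda}$ in $u$.\<close>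

definition dpow :: "'a::field_char_0 \<Rightarrow> 'a \<Rightarrow> 'a fps" where
  "dpow lam x = Abs_fps (\<lambda>m. dfalling lam x m / fact m)"

lemma dpow_eq_binomial:
  assumes "lam \<noteq> 0"
  shows "dpow lam x = fps_binomial (x / lam) oo (fps_const lam * fps_X)"
proof (rule fps_ext)
  fix n
  have "(\<Prod>i<n. x - of_nat i * lam) = (\<Prod>i<n. lam * (x / lam - of_nat i))"
    using assms by (intro prod.cong) (auto simp: field_simps)
  then show "dpow lam x $ n = (fps_binomial (x / lam) oo (fps_const lam * fps_X)) $ n"
    by (simp add: dpow_def dfalling_def fps_compose_linear gbinomial_prod_rev prod.distrib
        lessThan_atLeast0)
qed


section \<open>Degenerate Euler and Changhee polynomials\<close>

definition dEuler :: "nat \<Rightarrow> 'a::field_char_0 \<Rightarrow> 'a \<Rightarrow> 'a" where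
  "dEuler n \<mu> x = fact n * (fps_const 2 / (dpow \<mu> 1 + 1) * dpow \<mu> x) $ n"

text \<open>Here \<^term>\<open>fps_ln 1\<close> is the series $\log(1+t)$.\<close>

definition dChanghee :: "nat \<Rightarrow> 'a::field_char_0 \<Rightarrow> 'a \<Rightarrow> 'a" where
  "dChanghee n lam x =
     fact n * (fps_const 2 / (1 + (dpow lam 1 oo fps_ln 1)) * (dpow lam x oo fps_ln 1)) $ n"

end

theory Submission
  imports Defs
begin

text \<open>
  Put $E = (1+\lambda t)^{1/\lambda}$, so that $(1+\lambda t)^{a/\lambda} = E^a$. Rescaling
  $t \mapsto dt$ in the generating function of $\mathcal{E}_{m,\lambda/d}(a/d)$ turns it into
  $2E^a/(E^d+1)$, and since $d$ is odd the alternating sum over $a$ is a geometric sum which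
  collapses to $2/(E+1)$. Substituting $\log(1+t)$ for $t$ gives the claim, because
  $\log(1+t)^m/m!$ is the exponential generating function of $S_1(\cdot,m)$.
\<close>

lemma dpow_0 [simp]: "dpow lam 0 = 1"
  by (rule fps_ext) (auto simp: dpow_def dfalling_def intro!: prod_zero bexI[of _ 0])

lemma dpow_nth_0 [simp]: "dpow lam x $ 0 = 1"
  by (simp add: dpow_def dfalling_def)

text \<open>Vandermonde's convolution, in the form of the exponent law for
  \<open>fps_binomial\<close>, carried over by the substitution u -> lam u.\<close>

lemma dpow_add:
  assumes "lam \<noteq> 0"
  shows "dpow lam (x + y) = dpow lam x * dpow lam y"
  using assms
  by (simp add: dpow_eq_binomial add_divide_distrib fps_binomial_add_mult
      fps_compose_mult_distrib)

lemma dpow_of_nat: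
  assumes "lam \<noteq> 0"
  shows "dpow lam (of_nat a) = dpow lam 1 ^ a"
  by (induction a) (simp_all add: dpow_add[OF assms])

text \<open>Each of the n factors of the degenerate falling product absorbs one factor of
  \<open>c ^ n\<close>.\<close>

lemma dpow_compose_scale:
  assumes "c \<noteq> 0"
  shows "dpow (lam / c) x oo (fps_const c * fps_X) = dpow lam (c * x)"
proof (rule fps_ext)
  fix n
  have "(\<Prod>i<n. c * x - of_nat i * lam) = (\<Prod>i<n. c * (x - of_nat i * (lam / c)))"
    using assms by (intro prod.cong) (auto simp: field_simps)
  then show "(dpow (lam / c) x oo (fps_const c * fps_X)) $ n = dpow lam (c * x) $ n"
    by (simp add: dpow_def dfalling_def fps_compose_linear prod.distrib)
qed

lemma fps_const_divide_mult_self: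
  fixes F :: "'a::field fps"
  assumes "F $ 0 \<noteq> 0"
  shows "fps_const c / F * F = fps_const c"
  using assms by (simp add: fps_divide_unit mult.assoc inverse_mult_eq_1)

lemma dEuler_alternating_sum:
  fixes lam :: "'a::field_char_0"
  assumes lam: "lam \<noteq> 0" and d: "odd d"
  shows "of_nat d ^ m * (\<Sum>a<d. (-1) ^ a * dEuler m (lam / of_nat d) (of_nat a / of_nat d)) =
    fact m * (fps_const 2 / (1 + dpow lam 1)) $ m"
proof -
  define E where "E = dpow lam 1"
  define \<mu> where "\<mu> = lam / of_nat d"
  define r where "r = fps_const (of_nat d :: 'a) * fps_X"
  define G where "G = fps_const 2 / (dpow \<mu> 1 + 1)"
  have d0: "(of_nat d :: 'a) \<noteq> 0"
    using d by (auto elim: oddE)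
  have r0: "r $ 0 = 0"
    by (simp add: r_def)
  have scale: "dpow \<mu> (of_nat a / of_nat d) oo r = E ^ a" for a
    using dpow_compose_scale[OF d0, of lam "of_nat a / of_nat d"] d0
    by (simp add: \<mu>_def r_def E_def dpow_of_nat[OF lam])
  have "dpow \<mu> 1 oo r = E ^ d"
    using scale[of d] d0 by simp
  moreover have "G * (dpow \<mu> 1 + 1) = fps_const 2"
    unfolding G_def by (rule fps_const_divide_mult_self) simp
  \<comment> \<open>As \<open>r\<close> has no constant term, composition with it is a ring
    homomorphism, and it fixes constants.\<close>
  then have "(G oo r) * ((dpow \<mu> 1 oo r) + 1) = fps_const 2"
    by (metis fps_compose_mult_distrib[OF r0] fps_compose_add_distrib fps_compose_1
        fps_const_compose)
  ultimately have Gr: "(G oo r) * (1 + E ^ d) = fps_const 2"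
    by (simp add: add.commute)
  have "(1 + E) * (\<Sum>a<d. (- E) ^ a) = 1 - (- E) ^ d"
    using one_diff_power_eq[of "- E" d] by simp
  then have geo: "(1 + E) * (\<Sum>a<d. (- E) ^ a) = 1 + E ^ d"
    using d by simp
  have E0: "(1 + E) $ 0 \<noteq> 0"
    by (simp add: E_def)
  then have "1 + E \<noteq> 0" by force
  \<comment> \<open>With 2 expanded by \<open>Gr\<close> and then \<open>geo\<close>, both sides are
    the same product up to order; cancelling \<open>1 + E\<close> identifies the quotient.\<close>
  moreover have "(G oo r) * (\<Sum>a<d. (- E) ^ a) * (1 + E) = fps_const 2 / (1 + E) * (1 + E)"
    unfolding fps_const_divide_mult_self[OF E0] Gr[symmetric] geo[symmetric]
    by (simp add: mult_ac)
  ultimately have key: "(G oo r) * (\<Sum>a<d. (- E) ^ a) = fps_const 2 / (1 + E)"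
    using mult_right_cancel by blast
  \<comment> \<open>Composing with \<open>r\<close> multiplies the m-th coefficient by d^m, which
    accounts for the power of d in the claim.\<close>
  have dE: "of_nat d ^ m * dEuler m \<mu> (of_nat a / of_nat d) = fact m * ((G oo r) * E ^ a) $ m" for a
  proof -
    have "(G oo r) * E ^ a = (G * dpow \<mu> (of_nat a / of_nat d)) oo r"
      by (simp add: fps_compose_mult_distrib r0 scale)
    then have "((G oo r) * E ^ a) $ m = of_nat d ^ m * (G * dpow \<mu> (of_nat a / of_nat d)) $ m"
      by (simp only: r_def fps_compose_linear fps_nth_Abs_fps)
    then show ?thesis
      by (simp only: dEuler_def flip: G_def) (simp only: mult.left_commute)
  qed
  have "of_nat d ^ m * (\<Sum>a<d. (-1) ^ a * dEuler m \<mu> (of_nat a / of_nat d)) =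
    (\<Sum>a<d. (-1) ^ a * (fact m * ((G oo r) * E ^ a) $ m))"
    by (simp add: sum_distrib_left mult.left_commute dE)
  also have "\<dots> = (\<Sum>a<d. fact m * ((G oo r) * (- E) ^ a) $ m)"
  proof (intro sum.cong refl)
    fix a
    show "(-1) ^ a * (fact m * ((G oo r) * E ^ a) $ m) = fact m * ((G oo r) * (- E) ^ a) $ m"
      by (cases "even a") simp_all
  qed
  also have "\<dots> = fact m * ((G oo r) * (\<Sum>a<d. (- E) ^ a)) $ m"
    by (simp add: sum_distrib_left fps_sum_nth)
  finally show ?thesis
    unfolding key by (simp add: \<mu>_def E_def)
qed

lemma S1_0_left: "S1 0 m = (if m = 0 then 1 else 0)"
  by (simp add: S1_def)

lemma S1_Suc_0: "S1 (Suc n) 0 = - int n * S1 n 0"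
  by (simp add: S1_def)

lemma S1_Suc_Suc: "S1 (Suc n) (Suc m) = S1 n m - int n * S1 n (Suc m)"
  by (simp add: S1_def mult.commute[of "prod _ _"])

text \<open>The factor of index 0 is x itself, so there is no constant term.\<close>

lemma S1_Suc_0_eq_0: "S1 (Suc n) 0 = 0"
  by (induction n) (simp_all add: S1_Suc_0 S1_0_left)

text \<open>Since L' = 1/(1+X), the power L^(m+1) satisfies (1+X) (L^(m+1))' = (m+1) L^m; the claim
  compares coefficients of X^n.\<close>

lemma fps_ln_power_recurrence:
  fixes m n :: nat
  defines "L \<equiv> fps_ln (1 :: 'a::field_char_0)"
  shows "of_nat (Suc n) * (L ^ Suc m) $ Suc n + of_nat n * (L ^ Suc m) $ n =
    of_nat (Suc m) * (L ^ m) $ n"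
proof -
  have "fps_deriv (L ^ Suc m) = of_nat (Suc m) * L ^ m * inverse (1 + fps_X)"
    unfolding L_def fps_deriv_power fps_ln_deriv
    by (simp add: fps_of_nat[symmetric] mult_ac fps_divide_unit)
  then have "(1 + fps_X) * fps_deriv (L ^ Suc m) =
      of_nat (Suc m) * L ^ m * (inverse (1 + fps_X) * (1 + fps_X))"
    by (simp only: mult_ac)
  also have "inverse (1 + fps_X) * (1 + fps_X) = (1 :: 'a fps)"
    by (rule inverse_mult_eq_1) simp
  finally have "((1 + fps_X) * fps_deriv (L ^ Suc m)) $ n = (fps_const (of_nat (Suc m)) * L ^ m) $ n"
    by (simp only: fps_of_nat mult_1_right)
  then show ?thesis
    by (cases n) (simp_all add: distrib_right del: power_Suc)
qed

text \<open>After scaling by factorials, the differential equation of the powers of the logarithm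
  becomes the triangular recurrence of \<open>S1\<close>, which comes from splitting off the factor
  x - n.\<close>

lemma fps_ln_power_nth:
  "fact n * (fps_ln 1 ^ m) $ n = (fact m * of_int (S1 n m) :: 'a::field_char_0)"
proof (induction n arbitrary: m)
  case 0
  show ?case
    by (cases m) (simp_all add: S1_0_left fps_ln_def)
next
  case (Suc n)
  show ?case
  proof (cases m)
    case 0
    then show ?thesis by (simp add: S1_Suc_0_eq_0)
  next
    case (Suc k)
    let ?L = "fps_ln (1 :: 'a)"
    have "fact (Suc n) * (?L ^ Suc k) $ Suc n = fact n * (of_nat (Suc n) * (?L ^ Suc k) $ Suc n)"
      by (simp del: power_Suc of_nat_Suc add: fact_Suc mult_ac)
    \<comment> \<open>The recurrence, solved for the coefficient of index
      \<open>Suc n\<close>.\<close>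
    also have "\<dots> = fact n * (of_nat (Suc k) * (?L ^ k) $ n - of_nat n * (?L ^ Suc k) $ n)"
      by (simp only: fps_ln_power_recurrence[of n k, where 'a = 'a, symmetric] add_diff_cancel_right')
    also have "\<dots> = of_nat (Suc k) * (fact n * (?L ^ k) $ n) - of_nat n * (fact n * (?L ^ Suc k) $ n)"
      by (simp only: right_diff_distrib mult_ac)
    also have "\<dots> = fact (Suc k) * of_int (S1 (Suc n) (Suc k))"
      unfolding Suc.IH by (simp add: S1_Suc_Suc algebra_simps)
    finally show ?thesis using Suc by simp
  qed
qed

text \<open>Substituting log(1+t) commutes with the division: both quotients give 2 when multiplied
  by the invertible series \<open>1 + (dpow lam 1 oo fps_ln 1)\<close>. Expanding the composition
  then brings in the coefficients of the powers of the logarithm.\<close>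

lemma dChanghee_0_eq:
  "dChanghee n lam 0 = (\<Sum>m=0..n. fact m * (fps_const 2 / (1 + dpow lam 1)) $ m * of_int (S1 n m))"
proof -
  let ?L = "fps_ln (1 :: 'a)"
  let ?F = "fps_const 2 / (1 + dpow lam 1)"
  have L0: "?L $ 0 = 0" by (simp add: fps_ln_def)
  have "(?F * (1 + dpow lam 1)) oo ?L = fps_const 2"
    by (subst fps_const_divide_mult_self) simp_all
  then have *: "(?F oo ?L) * (1 + (dpow lam 1 oo ?L)) = fps_const 2"
    by (simp only: fps_compose_mult_distrib[OF L0] fps_compose_add_distrib fps_compose_1)
  have nz: "(1 + (dpow lam 1 oo ?L)) $ 0 \<noteq> 0"
    by simp
  then have "1 + (dpow lam 1 oo ?L) \<noteq> 0" by force
  then have "fps_const 2 / (1 + (dpow lam 1 oo ?L)) = ?F oo ?L"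
    using * fps_const_divide_mult_self[OF nz, of 2] mult_right_cancel by metis
  then have "dChanghee n lam 0 = fact n * (\<Sum>m=0..n. ?F $ m * (?L ^ m) $ n)"
    by (simp add: dChanghee_def fps_compose_nth)
  also have "\<dots> = (\<Sum>m=0..n. ?F $ m * (fact n * (?L ^ m) $ n))"
    by (simp only: sum_distrib_left mult.left_commute)
  finally show ?thesis
    by (simp only: fps_ln_power_nth mult_ac)
qed

theorem theorem2p6:
  fixes p :: nat and absp :: "'a::field_char_0 \<Rightarrow> real" and lam :: 'a and n d :: nat
  assumes "padic_complex p absp"
    and "odd p"
    and "lam \<noteq> 0"
    and "absp lam \<le> 1"
    and "odd d"
  shows "dChanghee n lam 0 =
    (\<Sum>m=0..n. of_nat d ^ m *
      (\<Sum>a<d. (-1) ^ a * dEuler m (lam / of_nat d) (of_nat a / of_nat d) * of_int (S1 n m)))"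
  \<comment> \<open>Each scaled coefficient of 2/(1+E) is replaced by its alternating Euler sum, and
    \<open>S1 n m\<close> is factored out of the sum over a.\<close>
  by (simp add: dChanghee_0_eq dEuler_alternating_sum[OF assms(3,5), symmetric]
      flip: sum_distrib_right mult.assoc)

end
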